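(* Let $p$ be an odd prime. Then $2p\in\mathbb{V}_{p+1}$.
   Context: Natural numbers are positive integers. Every natural number $n$ has a unique base $b$ representation ($b\ge 2$) $n=a_0+a_1b+\cdots+a_{L-1}b^{L-1}$ with $L\ge 1$, integers $0\le a_i<b$ and $a_{L-1}\ne 0$. The digit reversal of $n$ in base $b$ is $r_b(n)=a_{L-1}+a_{L-2}b+\cdots+a_0b^{L-1}$. The function $v$ on natural numbers: if $n=p_1^{\varepsilon_1}\cdots p_s^{\varepsilon_s}q_1\cdots q_t$ with $s,t\ge 0$, integers $\varepsilon_i\ge 2$ and distinct primes $p_1,\dots,p_s,q_1,\dots,q_t$, then $v(n)=\sum_{i=1}^s(p_i+\varepsilon_i)+\sum_{j=1}^t q_j$ (so $v(1)=0$). A natural number $n$ is a $v$-palindrome in base $b$ if (i) $b\nmid n$, (ii) $n\ne r_b(n)$, and (iii) $v(n)=v(r_b(n))$. The set of $v$-palindromes in base $b$ is denoted $\mathbb{V}_b$. *)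

theory Defs
  imports "HOL-Computational_Algebra.Primes"
begin

text \<open>Digits are listed from the least significant one upwards.\<close>

definition base_representation :: "nat \<Rightarrow> nat \<Rightarrow> nat list \<Rightarrow> bool" where
  "base_representation b n as \<longleftrightarrow>
     length as \<ge> 1 \<and> (\<forall>i<length as. as ! i < b) \<and> as ! (length as - 1) \<noteq> 0 \<and>
     n = (\<Sum>i<length as. as ! i * b ^ i)"

lemma base_representation_Cons:
  assumes "as \<noteq> []"
  shows "base_representation b n (a # as) \<longleftrightarrow>
     a < b \<and> (\<exists>m. base_representation b m as \<and> n = a + b * m)"
proof -
  have "(\<Sum>i<length (a # as). (a # as) ! i * b ^ i) = a + b * (\<Sum>i<length as. as ! i * b ^ i)"
    by (simp only: length_Cons sum.lessThan_Suc_shift) (simp add: sum_distrib_left algebra_simps)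
  moreover have "(\<forall>i<length (a # as). (a # as) ! i < b) \<longleftrightarrow> a < b \<and> (\<forall>i<length as. as ! i < b)"
    by (simp only: length_Cons All_less_Suc2) simp
  moreover have "(a # as) ! (length (a # as) - 1) = as ! (length as - 1)" "length as \<ge> 1"
    using assms by (cases as; simp)+
  ultimately show ?thesis
    unfolding base_representation_def by auto
qed

lemma base_representation_single:
  "base_representation b n [a] \<longleftrightarrow> a < b \<and> a \<noteq> 0 \<and> n = a"
  by (auto simp: base_representation_def)

lemma base_representation_pos:
  assumes "base_representation b n as"
  shows "n > 0"
proof -
  from assms have L: "length as - 1 < length as" and a: "as ! (length as - 1) \<noteq> 0"
    and n: "n = (\<Sum>i<length as. as ! i * b ^ i)"
    by (auto simp: base_representation_def)
  moreover have "b > 0"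
    using assms L unfolding base_representation_def by (metis gr0I not_less0)
  ultimately show ?thesis
    by (subst n, intro sum_pos2[of _ "length as - 1"]) auto
qed

lemma base_representation_ex1:
  assumes "b \<ge> 2" "n > 0"
  shows "\<exists>!as. base_representation b n as"
  using assms(2)
proof (induction n rule: less_induct)
  case (less n)
  show ?case
  proof (cases "n < b")
    case True
    show ?thesis
    proof (rule ex1I[of _ "[n]"])
      show "base_representation b n [n]"
        using True less.prems by (simp add: base_representation_single)
    next
      fix as assume as: "base_representation b n as"
      then obtain a bs where abs: "as = a # bs"
        by (cases as) (auto simp: base_representation_def)
      show "as = [n]"
      proof (cases "bs = []")
        case True
        then show ?thesis using as abs by (simp add: base_representation_single)
      next
        case False
        then obtain m where m: "base_representation b m bs" "n = a + b * m"
          using as abs by (auto simp: base_representation_Cons)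
        then have "b * 1 \<le> b * m"
          using base_representation_pos by (intro mult_le_mono2) (simp add: Suc_le_eq)
        then show ?thesis using m(2) \<open>n < b\<close> by linarith
      qed
    qed
  next
    case False
    have "n div b < n" "n div b > 0"
      using False assms(1) less.prems by (auto simp: div_greater_zero_iff)
    then obtain as where as: "base_representation b (n div b) as"
      and uniq: "\<And>bs. base_representation b (n div b) bs \<Longrightarrow> bs = as"
      using less.IH by blast
    have ne: "as \<noteq> []" using as by (auto simp: base_representation_def)
    show ?thesis
    proof (rule ex1I[of _ "n mod b # as"])
      show "base_representation b n (n mod b # as)"
        unfolding base_representation_Cons[OF ne]
        using as assms(1) by (intro conjI exI[of _ "n div b"]) auto
    next
      fix cs assume cs: "base_representation b n cs"
      then obtain c ds where cds: "cs = c # ds"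
        by (cases cs) (auto simp: base_representation_def)
      have "ds \<noteq> []"
        using cs cds False by (auto simp: base_representation_single)
      then obtain m where m: "base_representation b m ds" "n = c + b * m" "c < b"
        using cs cds by (auto simp: base_representation_Cons)
      then have "n mod b = c" "n div b = m" by auto
      then show "cs = n mod b # as"
        using m uniq cds by auto
    qed
  qed
qed

definition base_digits :: "nat \<Rightarrow> nat \<Rightarrow> nat list" where
  "base_digits b n = (THE as. base_representation b n as)"

definition digit_reversal :: "nat \<Rightarrow> nat \<Rightarrow> nat" where
  "digit_reversal b n =
     (let as = base_digits b n; L = length as in \<Sum>i<L. as ! (L - 1 - i) * b ^ i)"

definition v :: "nat \<Rightarrow> nat" where
  "v n = (\<Sum>p\<in>prime_factors n.
            if multiplicity p n \<ge> 2 then p + multiplicity p n else p)"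

definition v_palindromes :: "nat \<Rightarrow> nat set" where
  "v_palindromes b =
     {n. n > 0 \<and> \<not> b dvd n \<and> n \<noteq> digit_reversal b n \<and> v n = v (digit_reversal b n)}"

end

theory Submission
  imports Defs
begin

text \<open>
  Write \<open>b = p + 1\<close>. Since \<open>2 * p = (p - 1) + 1 * b\<close>, the number \<open>2 * p\<close> has the two digits
  \<open>p - 1\<close> and \<open>1\<close>, and swapping them gives \<open>1 + (p - 1) * (p + 1) = p\<^sup>2\<close>. The function \<open>v\<close>
  cannot tell the two apart: the prime \<open>2\<close> of \<open>2 * p\<close> contributes \<open>2\<close> as a prime, whereas in
  \<open>p\<^sup>2\<close> the same amount \<open>2\<close> comes from the exponent, so both values are \<open>p + 2\<close>.
\<close>

lemma base_digits_eqI: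
  assumes "b \<ge> 2" and "base_representation b n as"
  shows "base_digits b n = as"
  unfolding base_digits_def
  using assms base_representation_ex1[OF assms(1) base_representation_pos[OF assms(2)]]
  by (intro the1_equality)

lemma digit_reversal_two_digits:
  assumes "a < b" "c < b" "c \<noteq> 0"
  shows "digit_reversal b (a + b * c) = c + b * a"
proof (cases "b = 1")
  case False
  have "base_digits b (a + b * c) = [a, c]"
    using assms False
    by (intro base_digits_eqI) (auto simp: base_representation_Cons base_representation_single)
  then show ?thesis
    by (simp add: digit_reversal_def Let_def)
qed (use assms in simp)

lemma v_mult_distinct_primes:
  assumes "prime p" "prime q" "p \<noteq> q"
  shows "v (p * q) = p + q"
proof -
  have "prime_factorization (p * q) = {#p, q#}"
    using assms by (subst prime_factorization_mult) (auto simp: prime_factorization_prime)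
  moreover have "multiplicity p (p * q) = 1" "multiplicity q (p * q) = 1"
    using assms
    by (simp_all add: prime_elem_multiplicity_mult_distrib prime_multiplicity_other)
  ultimately show ?thesis
    using assms(3) by (simp add: v_def)
qed

lemma v_prime_power:
  assumes "prime p" "k \<ge> 2"
  shows "v (p ^ k) = p + k"
  using assms
  by (simp add: v_def prime_factorization_prime_power set_mset_replicate_mset_subset
      multiplicity_same_power not_prime_unit)

theorem theorem8:
  fixes p :: nat
  assumes "prime p" and "odd p"
  shows "2 * p \<in> v_palindromes (p + 1)"
proof -
  have p3: "p \<ge> 3"
    using assms prime_ge_2_nat[of p] by (cases "p = 2") auto
  have expansion: "2 * p = (p - 1) + (p + 1) * 1"
    using p3 by simp
  have "digit_reversal (p + 1) (2 * p) = 1 + (p + 1) * (p - 1)"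
    unfolding expansion using p3 by (intro digit_reversal_two_digits) auto
  also have "\<dots> = p\<^sup>2"
    using p3 by (cases p) (auto simp: power2_eq_square)
  finally have rev: "digit_reversal (p + 1) (2 * p) = p\<^sup>2" .
  have "(2 * p) mod (p + 1) = p - 1"
    unfolding expansion by (subst mod_mult_self2) simp
  then have "\<not> p + 1 dvd 2 * p"
    using p3 by (simp add: dvd_eq_mod_eq_0)
  moreover have "2 * p \<noteq> p\<^sup>2"
    using p3 by (simp add: power2_eq_square)
  moreover have "v (2 * p) = v (p\<^sup>2)"
    using assms p3 by (simp add: v_mult_distinct_primes v_prime_power)
  ultimately show ?thesis
    using p3 by (simp add: v_palindromes_def rev[simplified])
qed

end
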